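(* Consider the binary case $p_0=p_2=\tfrac12$ of the Galton–Watson process, with terminal tree $T$, number of leaves $L$, and number of leaves $\mathcal L$ of the uniformly random full subtree of $T$. (i) For all integers $1\le t\le \ell$, $$\mathbb P(\mathcal L=t\mid L=\ell)=\frac{t}{\ell(2\ell-1)}\cdot\frac{\binom{\ell}{t}^2}{\binom{2(\ell-1)}{2(t-1)}}.$$ (ii) Consequently, as $\ell\to\infty$, for $t=t(\ell)\ge 1$ with $t=o(\ell)$, $$\mathbb P(\mathcal L=t\mid L=\ell)=\frac{1+O(\ell^{-1/2}+t/\ell)}{2^{2t-1}\,t}\binom{2(t-1)}{t-1}=\bigl(1+O(\ell^{-1/2}+t/\ell)\bigr)\,\mathbb P(L=t),$$ and the sequence (indexed by $\ell\ge1$) of probability distributions $\{\mathbb P(\mathcal L=t\mid L=\ell)\}_{t\ge 1}$ is tight. However, $\mathbb E[\mathcal L\mid L=\ell]\sim \tfrac{\sqrt{\pi \ell}}{2}$ as $\ell\to\infty$.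
   Context: Let $\{p_j\}_{j\ge0}$ be a probability distribution on the nonnegative integers (here $p_0=p_2=\tfrac12$ and $p_j=0$ otherwise). The Galton–Watson branching process starts from a single progenitor; each member independently has $j$ (ordered) children with probability $p_j$. The resulting family tree is a rooted ordered tree; since $p_0>0$ and $\sum_j jp_j=1$, it is finite with probability $1$. Denote this terminal (extinction) tree by $T$, so that for every finite rooted ordered tree $\mathcal T$, $\mathbb P(T=\mathcal T)=\prod_{v}p_{d(v,\mathcal T)}$, the product being over the vertices $v$ of $\mathcal T$, with $d(v,\mathcal T)$ the out-degree (number of children) of $v$. $L$ is the number of leaves of $T$ (vertices of out-degree $0$). A (full) subtree of $T$ is the subtree consisting of a vertex $v$ of $T$ and all its descendants, so that full subtrees correspond one-to-one to vertices of $T$. $X(t)$ is the number of full subtrees of $T$ having exactly $t$ leaves, and $V=\sum_{t\ge1}X(t)$ is the number of vertices of $T$. $\mathcal L$ is the number of leaves in the full subtree chosen uniformly at random among all $V$ full subtrees of $T$: $\mathbb P(\mathcal L=t\mid T)=X(t)/V$, and hence $\mathbb P(\mathcal L=t\mid L=\ell)=\mathbb E[X(t)/V\mid L=\ell]$. *)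

theory Defs
  imports
    "HOL-Probability.Probability_Mass_Function"
    "HOL-Probability.Helly_Selection"
    "HOL-Library.Landau_Symbols"
begin

datatype tree = Node (children: "tree list")

text \<open>
  A vertex is the list of child indices on the path from the root to it (Ulam--Harris address).
\<close>

function vertices :: "tree \<Rightarrow> nat list set" where
  "vertices (Node ts) = insert [] (\<Union>i<length ts. (#) i ` vertices (ts ! i))"
  by pat_completeness auto
termination
  by (relation "Wellfounded.measure size") (auto simp: less_Suc_eq_le intro!: size_list_estimation' nth_mem)

fun full_subtree :: "tree \<Rightarrow> nat list \<Rightarrow> tree" where
  "full_subtree T [] = T"
| "full_subtree T (i # v) = full_subtree (children T ! i) v"

definition out_degree :: "tree \<Rightarrow> nat list \<Rightarrow> nat" where
  "out_degree T v = length (children (full_subtree T v))"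

definition num_leaves :: "tree \<Rightarrow> nat" where
  "num_leaves T = card {v \<in> vertices T. out_degree T v = 0}"

definition num_fringe :: "tree \<Rightarrow> nat \<Rightarrow> nat" where
  "num_fringe T t = card {v \<in> vertices T. num_leaves (full_subtree T v) = t}"

definition gw_weight :: "nat pmf \<Rightarrow> tree \<Rightarrow> real" where
  "gw_weight p T = (\<Prod>v\<in>vertices T. pmf p (out_degree T v))"

text \<open>
  The law of the terminal tree. This is meaningful when the process dies out almost surely, i.e.
  when the weights add up to 1; see \<open>pmf_gw_tree\<close> and \<open>gw_tree_branching\<close> for the binary case.
\<close>

definition gw_tree :: "nat pmf \<Rightarrow> tree pmf" where
  "gw_tree p = embed_pmf (gw_weight p)"

definition binary_offspring :: "nat pmf" where
  "binary_offspring = pmf_of_set {0, 2}"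

definition gw_tree_vertex :: "nat pmf \<Rightarrow> (tree \<times> nat list) pmf" where
  "gw_tree_vertex p =
     do {T \<leftarrow> gw_tree p; v \<leftarrow> pmf_of_set (vertices T); return_pmf (T, v)}"

text \<open>
  The conditional law of the number of leaves of a uniformly random full subtree, given that the
  terminal tree has \<open>l\<close> leaves. If the conditioning event is null (for \<open>binary_offspring\<close>: only for
  \<open>l = 0\<close>), the value is unspecified.
\<close>

definition fringe_law :: "nat pmf \<Rightarrow> nat \<Rightarrow> nat pmf" where
  "fringe_law p l =
     map_pmf (\<lambda>(T, v). num_leaves (full_subtree T v))
       (cond_pmf (gw_tree_vertex p) {(T, v). num_leaves T = l})"


declare vertices.simps [simp del]
lemmas vertices_Node = vertices.simps

lemma finite_vertices [simp]: "finite (vertices T)"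
  by (induction T rule: vertices.induct) (auto simp: vertices_Node)

lemma vertices_nonempty [simp]: "vertices T \<noteq> {}"
  by (cases T) (simp add: vertices_Node)

lemma full_subtree_Node [simp]:
  "full_subtree (Node ts) (i # v) = full_subtree (ts ! i) v"
  by simp

lemma out_degree_Node [simp]:
  "out_degree (Node ts) [] = length ts"
  "out_degree (Node ts) (i # v) = out_degree (ts ! i) v"
  by (simp_all add: out_degree_def)

lemma gw_weight_Node:
  "gw_weight p (Node ts) = pmf p (length ts) * (\<Prod>i<length ts. gw_weight p (ts ! i))"
proof -
  let ?B = "\<lambda>i. (#) i ` vertices (ts ! i)"
  have "gw_weight p (Node ts) =
      pmf p (length ts) * (\<Prod>v\<in>(\<Union>i<length ts. ?B i). pmf p (out_degree (Node ts) v))"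
    unfolding gw_weight_def vertices_Node by (subst prod.insert) auto
  also have "(\<Prod>v\<in>(\<Union>i<length ts. ?B i). pmf p (out_degree (Node ts) v)) =
      (\<Prod>i<length ts. \<Prod>v\<in>?B i. pmf p (out_degree (Node ts) v))"
    by (subst prod.UNION_disjoint) auto
  also have "\<dots> = (\<Prod>i<length ts. gw_weight p (ts ! i))"
    unfolding gw_weight_def by (rule prod.cong[OF refl], subst prod.reindex) auto
  finally show ?thesis .
qed

lemma gw_weight_Node_list:
  "gw_weight p (Node ts) = pmf p (length ts) * prod_list (map (gw_weight p) ts)"
proof -
  have "prod_list (map (gw_weight p) ts) = (\<Prod>i<length ts. gw_weight p (ts ! i))"
    by (induction ts) (simp_all add: prod.lessThan_Suc_shift del: prod.lessThan_Suc)
  then show ?thesis by (simp add: gw_weight_Node)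
qed

lemma gw_weight_nonneg [simp]: "gw_weight p T \<ge> 0"
  by (simp add: gw_weight_def prod_nonneg)

lemma pmf_binary_offspring: "pmf binary_offspring n = (if n = 0 \<or> n = 2 then 1 / 2 else 0)"
  by (simp add: binary_offspring_def indicator_def)

lemma gw_weight_binary:
  "gw_weight binary_offspring (Node []) = 1 / 2"
  "gw_weight binary_offspring (Node [a, b]) =
     gw_weight binary_offspring a * gw_weight binary_offspring b / 2"
  "ts \<noteq> [] \<Longrightarrow> length ts \<noteq> 2 \<Longrightarrow> gw_weight binary_offspring (Node ts) = 0"
  by (simp_all add: gw_weight_Node_list pmf_binary_offspring)

primrec height :: "tree \<Rightarrow> nat" where
  "height (Node ts) = Suc (Max (insert 0 (set (map height ts))))"

lemma height_Node2: "height (Node [a, b]) = Suc (max (height a) (height b))"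
  by simp

lemma nn_integral_binary:
  fixes f :: "tree \<Rightarrow> ennreal"
  assumes "\<And>ts. ts \<noteq> [] \<Longrightarrow> length ts \<noteq> 2 \<Longrightarrow> f (Node ts) = 0"
  shows "(\<integral>\<^sup>+T. f T \<partial>count_space UNIV) =
           f (Node []) + (\<integral>\<^sup>+a. \<integral>\<^sup>+b. f (Node [a, b]) \<partial>count_space UNIV \<partial>count_space UNIV)"
proof -
  let ?g = "\<lambda>(a, b). Node [a, b]"
  have mem: "Node ts \<in> range ?g" if len: "length ts = 2" for ts
  proof -
    from len obtain a b where "ts = [a, b]"
      by (auto simp: length_Suc_conv numeral_2_eq_2)
    then show ?thesis by (auto intro!: image_eqI[of _ _ "(a, b)"])
  qed
  have split: "f T = f T * indicator {Node []} T + f T * indicator (range ?g) T" for T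
    using assms mem by (cases T) (auto simp: indicator_def split: if_splits)
  have "(\<integral>\<^sup>+T. f T \<partial>count_space UNIV) = (\<integral>\<^sup>+T. f T * indicator {Node []} T \<partial>count_space UNIV)
      + (\<integral>\<^sup>+T. f T * indicator (range ?g) T \<partial>count_space UNIV)"
    by (subst split, subst nn_integral_add) auto
  also have "(\<integral>\<^sup>+T. f T * indicator {Node []} T \<partial>count_space UNIV) = f (Node [])"
    by (subst nn_integral_count_space_indicator[symmetric]) (auto simp: nn_integral_count_space_finite)
  also have "(\<integral>\<^sup>+T. f T * indicator (range ?g) T \<partial>count_space UNIV) = 
       (\<integral>\<^sup>+T. f T \<partial>count_space (range ?g))"
    by (subst nn_integral_count_space_indicator[symmetric]) auto
  also have "\<dots> = (\<integral>\<^sup>+x. f (?g x) \<partial>count_space UNIV)"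
    by (rule nn_integral_bij_count_space[symmetric]) (auto simp: bij_betw_def inj_on_def)
  also have "\<dots> = (\<integral>\<^sup>+a. \<integral>\<^sup>+b. f (Node [a, b]) \<partial>count_space UNIV \<partial>count_space UNIV)"
    by (subst nn_integral_fst_count_space[symmetric]) simp
  finally show ?thesis .
qed

lemma gw_weight_binary_product:
  fixes g :: "tree \<Rightarrow> ennreal"
  shows "(\<integral>\<^sup>+a. \<integral>\<^sup>+b. ennreal (gw_weight binary_offspring (Node [a, b])) * (g a * g b)
            \<partial>count_space UNIV \<partial>count_space UNIV)
         = ennreal (1 / 2) * (\<integral>\<^sup>+a. ennreal (gw_weight binary_offspring a) * g a \<partial>count_space UNIV) ^ 2"
proof -
  let ?w = "\<lambda>T. ennreal (gw_weight binary_offspring T)"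
  have "?w (Node [a, b]) * (g a * g b) = ennreal (1 / 2) * ((?w a * g a) * (?w b * g b))" for a b
  proof -
    have "?w (Node [a, b]) = ennreal (1 / 2 * (gw_weight binary_offspring a * gw_weight binary_offspring b))"
      by (simp add: gw_weight_binary)
    also have "\<dots> = ennreal (1 / 2) * (?w a * ?w b)"
      by (subst ennreal_mult, simp, simp, subst ennreal_mult) simp_all
    finally show ?thesis by (simp add: mult_ac)
  qed
  then show ?thesis
    by (simp add: nn_integral_cmult nn_integral_multc power2_eq_square del: ennreal_half)
qed

lemma gw_weight_binary_sum:
  "(\<integral>\<^sup>+T. ennreal (gw_weight binary_offspring T) \<partial>count_space UNIV) = 1"
proof -
  let ?w = "\<lambda>T. ennreal (gw_weight binary_offspring T)"
  define W where "W n = (\<integral>\<^sup>+T. ?w T * indicator {T. height T \<le> n} T \<partial>count_space UNIV)" for n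
  have half: "ennreal (1 / 2) + ennreal (1 / 2) = 1"
  proof -
    have "ennreal (1 / 2) + ennreal (1 / 2) = ennreal (1 / 2 + 1 / 2)"
      by (rule ennreal_plus[symmetric]) auto
    then show ?thesis by (simp del: ennreal_half)
  qed
  have W_le: "W n \<le> 1" for n
  proof (induction n)
    case 0
    have "height T \<noteq> 0" for T by (cases T) simp
    then have "{T. height T \<le> 0} = {}" by simp
    then show ?case unfolding W_def by simp
  next
    case (Suc n)
    have "W (Suc n) = ennreal (1 / 2) +
       (\<integral>\<^sup>+a. \<integral>\<^sup>+b. ?w (Node [a, b]) * (indicator {T. height T \<le> n} a * indicator {T. height T \<le> n} b)
         \<partial>count_space UNIV \<partial>count_space UNIV)"
      unfolding W_def
      by (subst nn_integral_binary)
         (auto simp: gw_weight_binary indicator_def simp del: nn_integral_indicator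
               intro!: arg_cong2[of _ _ _ _ "(+)"] nn_integral_cong)
    also have "\<dots> = ennreal (1 / 2) + ennreal (1 / 2) * W n ^ 2"
      unfolding W_def by (subst gw_weight_binary_product) simp
    also have "\<dots> \<le> ennreal (1 / 2) + ennreal (1 / 2) * 1 ^ 2"
      by (intro add_left_mono mult_left_mono power_mono Suc.IH) auto
    finally show ?case by (simp only: power_one mult_1_right half)
  qed
  define S where "S = (\<integral>\<^sup>+T. ?w T \<partial>count_space UNIV)"
  have "S = (\<integral>\<^sup>+T. (SUP n. ?w T * indicator {T. height T \<le> n} T) \<partial>count_space UNIV)"
  proof -
    have "(SUP n. ?w T * indicator {T. height T \<le> n} T) = ?w T" for T
      by (intro antisym SUP_least SUP_upper2[of "height T"]) (auto simp: indicator_def)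
    then show ?thesis by (simp add: S_def)
  qed
  also have "\<dots> = (SUP n. W n)"
    unfolding W_def
    by (rule nn_integral_monotone_convergence_SUP)
       (auto simp: incseq_def le_fun_def indicator_def)
  also have "\<dots> \<le> 1" by (rule SUP_least) (rule W_le)
  finally have S_le: "S \<le> 1" .
  have "S = ennreal (1 / 2) + ennreal (1 / 2) * S ^ 2"
    unfolding S_def
    by (subst nn_integral_binary)
       (use gw_weight_binary_product[of "\<lambda>_. 1"] in \<open>auto simp: gw_weight_binary\<close>)
  moreover obtain s where s: "S = ennreal s" "s \<ge> 0"
    using S_le by (cases S) (auto simp: top_unique)
  ultimately have "ennreal s = ennreal (1 / 2 + 1 / 2 * s ^ 2)"
    by (subst ennreal_plus, simp, simp, subst ennreal_mult) (simp_all add: ennreal_power)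
  then have "s = 1 / 2 + 1 / 2 * s ^ 2"
    by (subst (asm) ennreal_inj) (use s in auto)
  then have "(s - 1) ^ 2 = 0" by (simp add: power2_eq_square algebra_simps)
  then show ?thesis using s by (simp add: S_def)
qed

lemma pmf_gw_tree: "pmf (gw_tree binary_offspring) T = gw_weight binary_offspring T"
  unfolding gw_tree_def by (rule pmf_embed_pmf) (simp_all add: gw_weight_binary_sum)

lemma pmf_replicate_pmf:
  "pmf (replicate_pmf n p) xs = (if length xs = n then prod_list (map (pmf p) xs) else 0)"
proof (induction n arbitrary: xs)
  case (Suc n)
  show ?case
  proof (cases xs)
    case Nil
    then show ?thesis by (auto simp: pmf_eq_0_set_pmf)
  next
    case (Cons y ys)
    have "replicate_pmf (Suc n) p = map_pmf (\<lambda>(x, xs). x # xs) (pair_pmf p (replicate_pmf n p))"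
      by (simp add: pair_pmf_def map_bind_pmf)
    moreover have "inj (\<lambda>(x, xs). x # xs)" by (auto simp: inj_def)
    from pmf_map_inj'[OF this, of "pair_pmf p (replicate_pmf n p)" "(y, ys)"]
    have "pmf (map_pmf (\<lambda>(x, xs). x # xs) (pair_pmf p (replicate_pmf n p))) (y # ys) =
      pmf p y * pmf (replicate_pmf n p) ys"
      by (simp add: pmf_pair)
    ultimately show ?thesis using Cons Suc by simp
  qed
qed simp

text \<open>
  The branching property: the progenitor has a random number of children, whose families are
  independent copies of the whole tree.
\<close>

lemma gw_tree_branching:
  "gw_tree binary_offspring =
     do {j \<leftarrow> binary_offspring;
         ts \<leftarrow> replicate_pmf j (gw_tree binary_offspring);
         return_pmf (Node ts)}"
  (is "_ = ?R")
proof (rule pmf_eqI)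
  fix T
  obtain ts where T: "T = Node ts" by (cases T)
  have "inj Node" by (auto simp: inj_def)
  have eq: "pmf (map_pmf Node (replicate_pmf j (gw_tree binary_offspring))) T =
        indicator {length ts} j * prod_list (map (gw_weight binary_offspring) ts)" for j
    unfolding T pmf_map_inj'[OF \<open>inj Node\<close>]
    by (auto simp: pmf_replicate_pmf pmf_gw_tree indicator_def cong: map_cong)
  have "pmf ?R T = measure_pmf.expectation binary_offspring
     (\<lambda>j. indicator {length ts} j * prod_list (map (gw_weight binary_offspring) ts))"
    by (simp add: pmf_bind map_pmf_def[symmetric] eq)
  also have "\<dots> = gw_weight binary_offspring T"
    by (simp add: T gw_weight_Node_list pmf.rep_eq)
  finally show "pmf (gw_tree binary_offspring) T = pmf ?R T" by (simp add: pmf_gw_tree)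
qed

text \<open>
  Given the tree, the number of leaves of the random full subtree equals \<open>t\<close> with probability
  \<open>X(t) / V\<close>.
\<close>

lemma pmf_random_fringe:
  "pmf (map_pmf (\<lambda>v. num_leaves (full_subtree T v)) (pmf_of_set (vertices T))) t =
     num_fringe T t / card (vertices T)"
  by (simp add: pmf_map measure_pmf_of_set num_fringe_def vimage_def Int_def conj_commute)

lemma num_leaves_Node2:
  "num_leaves (Node [a, b]) = num_leaves a + num_leaves b"
proof -
  let ?L = "\<lambda>T. {v \<in> vertices T. out_degree T v = 0}"
  have "?L (Node [a, b]) = (#) 0 ` ?L a \<union> (#) 1 ` ?L b"
    by (auto simp: vertices_Node lessThan_Suc numeral_2_eq_2)
  moreover have "card ((#) 0 ` ?L a \<union> (#) 1 ` ?L b) = card ((#) 0 ` ?L a) + card ((#) 1 ` ?L b)"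
    by (rule card_Un_disjoint) auto
  ultimately show ?thesis
    by (simp add: num_leaves_def card_image)
qed

lemma exists_binary_tree:
  assumes "l \<ge> 1"
  shows "\<exists>T\<in>set_pmf (gw_tree binary_offspring). num_leaves T = l"
  using assms
proof (induction l rule: nat_induct_at_least)
  case base
  have "{v \<in> vertices (Node []). out_degree (Node []) v = 0} = {[]}" by (auto simp: vertices_Node)
  then have "num_leaves (Node []) = 1" by (simp add: num_leaves_def)
  then show ?case
    by (intro bexI[of _ "Node []"]) (auto simp: set_pmf_iff pmf_gw_tree gw_weight_binary)
next
  case (Suc l)
  then obtain T where T: "gw_weight binary_offspring T \<noteq> 0" "num_leaves T = l"
    by (auto simp: set_pmf_iff pmf_gw_tree)
  have "{v \<in> vertices (Node []). out_degree (Node []) v = 0} = {[]}" by (auto simp: vertices_Node)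
  then have "num_leaves (Node []) = 1" by (simp add: num_leaves_def)
  with T show ?case
    by (intro bexI[of _ "Node [Node [], T]"])
       (auto simp: set_pmf_iff pmf_gw_tree gw_weight_binary num_leaves_Node2)
qed

text \<open>Hence the conditioning event in \<open>fringe_law\<close> has positive probability for every \<open>l \<ge> 1\<close>.\<close>

lemma conditioning_event_nonnull:
  assumes "l \<ge> 1"
  shows "set_pmf (gw_tree_vertex binary_offspring) \<inter> {(T, v). num_leaves T = l} \<noteq> {}"
proof -
  obtain T where "T \<in> set_pmf (gw_tree binary_offspring)" "num_leaves T = l"
    using exists_binary_tree[OF assms] by blast
  moreover obtain v where "v \<in> vertices T" using vertices_nonempty by blast
  ultimately have "(T, v) \<in> set_pmf (gw_tree_vertex binary_offspring) \<inter> {(T, v). num_leaves T = l}"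
    by (auto simp: gw_tree_vertex_def)
  then show ?thesis by blast
qed

lemma pmf_bind_pair:
  "pmf (do {x \<leftarrow> P; y \<leftarrow> K x; return_pmf (x, y)}) (a, b) = pmf P a * pmf (K a) b"
proof -
  have eq: "pmf (map_pmf (Pair x) (K x)) (a, b) = indicator {a} x * pmf (K a) b" for x
  proof (cases "x = a")
    case True
    then show ?thesis using pmf_map_inj'[of "Pair a" "K a" b] by (simp add: inj_def)
  next
    case False
    then show ?thesis by (auto simp: pmf_eq_0_set_pmf)
  qed
  have "pmf (do {x \<leftarrow> P; y \<leftarrow> K x; return_pmf (x, y)}) (a, b) =
      measure_pmf.expectation P (\<lambda>x. indicator {a} x * pmf (K a) b)"
    by (simp add: map_pmf_def[symmetric] pmf_bind eq)
  then show ?thesis by (simp add: pmf.rep_eq)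
qed

text \<open>
  In terms of \<open>X\<close>, \<open>V\<close> and \<open>L\<close>, \<open>fringe_law\<close> is given by
  \<open>P(t) = E[X(t) / V | L = l]\<close>.
\<close>

lemma pmf_fringe_law:
  assumes "l \<ge> 1"
  shows "pmf (fringe_law binary_offspring l) t =
    measure_pmf.expectation (cond_pmf (gw_tree binary_offspring) {T. num_leaves T = l})
      (\<lambda>T. num_fringe T t / card (vertices T))"
proof -
  let ?P = "gw_tree binary_offspring" and ?K = "\<lambda>T. pmf_of_set (vertices T)"
  let ?S = "{T. num_leaves T = l}" and ?S' = "{(T, v :: nat list). num_leaves T = l}"
  have ne: "set_pmf ?P \<inter> ?S \<noteq> {}"
    using exists_binary_tree[OF assms] by auto
  note ne' = conditioning_event_nonnull[OF assms]
  have fst: "map_pmf fst (gw_tree_vertex binary_offspring) = ?P"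
    by (simp add: gw_tree_vertex_def map_bind_pmf bind_return_pmf')
  have "measure_pmf.prob ?P ?S = measure_pmf.prob (gw_tree_vertex binary_offspring) (fst -` ?S)"
    by (subst fst[symmetric], subst measure_map_pmf) simp
  moreover have "fst -` ?S = ?S'" by auto
  ultimately have meas: "measure_pmf.prob (gw_tree_vertex binary_offspring) ?S' = measure_pmf.prob ?P ?S"
    by simp
  have "cond_pmf (gw_tree_vertex binary_offspring) ?S' =
    do {T \<leftarrow> cond_pmf ?P ?S; v \<leftarrow> ?K T; return_pmf (T, v)}"
  proof (rule pmf_eqI)
    fix x :: "tree \<times> nat list"
    obtain T v where x: "x = (T, v)" by (cases x)
    have "pmf (gw_tree_vertex binary_offspring) (T, v) = pmf ?P T * pmf (?K T) v"
      unfolding gw_tree_vertex_def by (rule pmf_bind_pair)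
    then show "pmf (cond_pmf (gw_tree_vertex binary_offspring) ?S') x =
      pmf (do {T \<leftarrow> cond_pmf ?P ?S; v \<leftarrow> ?K T; return_pmf (T, v)}) x"
      unfolding x pmf_bind_pair by (simp add: pmf_cond[OF ne] pmf_cond[OF ne'] meas)
  qed
  then have "fringe_law binary_offspring l =
    do {T \<leftarrow> cond_pmf ?P ?S; map_pmf (\<lambda>v. num_leaves (full_subtree T v)) (?K T)}"
    by (simp add: fringe_law_def map_bind_pmf) (simp add: map_pmf_def)
  then show ?thesis by (simp add: pmf_bind pmf_random_fringe)
qed

end

theory Submission
  imports
    Defs
    "HOL-Analysis.Gamma_Function"
    "HOL-Computational_Algebra.Formal_Power_Series"
    "HOL-Real_Asymp.Real_Asymp"
begin

text \<open>
  Given \<open>L = l\<close>, the tree is uniform on the binary trees with \<open>l\<close> leaves, all of which have \<open>2l - 1\<close>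
  vertices. Let \<open>C\<close> be the generating function of the numbers \<open>C\<^sub>l\<close> of these trees. Splitting at the
  root gives \<open>C = X + C\<^sup>2\<close> and, for the generating function \<open>N\<close> of the total number of full subtrees
  with \<open>t\<close> leaves, \<open>N = C\<^sub>t X\<^sup>t + 2 C N\<close>. As \<open>1 - 2 C\<close> is the square root of \<open>1 - 4 X\<close>, its inverse
  is the generating function of the central binomial coefficients \<open>c\<^sub>n\<close>, so that the coefficient of
  \<open>X\<^sup>l\<close> in \<open>N\<close> is \<open>C\<^sub>t c\<^sub>l\<^sub>-\<^sub>t\<close>. With \<open>a\<^sub>n = c\<^sub>n / 4\<^sup>n\<close> this means
  \<open>P(\<L> = t | L = l) = 2l / (2l - 1) * a\<^sub>l\<^sub>-\<^sub>t / a\<^sub>l\<^sub>-\<^sub>1 * P(L = t)\<close>. Since \<open>a\<^sub>n\<close> decreases and \<open>n a\<^sub>n\<close>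
  increases, the factor of \<open>P(L = t)\<close> lies between 1 and \<open>1 + 2t / l\<close> (if \<open>2t \<le> l\<close>). The mean is
  \<open>l / ((2l - 1) a\<^sub>l\<^sub>-\<^sub>1)\<close>, because the convolution square of \<open>a\<close> is 1, and Wallis' product gives its
  asymptotics.
\<close>

unbundle no vec_syntax and fps_syntax

section \<open>Central binomial coefficients and their generating function\<close>

lemma central_binomial_fact: "real (2 * n choose n) = fact (2 * n) / (fact n * fact n)"
  by (subst binomial_fact) (simp_all add: mult_2)

lemma central_binomial_Suc:
  "real (Suc n) * real (2 * Suc n choose Suc n) = 2 * (2 * real n + 1) * real (2 * n choose n)"
proof -
  have "2 * Suc n = Suc (Suc (2 * n))" by simp
  then have "(fact (2 * Suc n) :: real) = (2 * real n + 2) * ((2 * real n + 1) * fact (2 * n))"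
    by (simp only: fact_Suc) (simp add: algebra_simps)
  moreover have "(fact (Suc n) :: real) = (real n + 1) * fact n"
    by (simp only: fact_Suc) simp
  ultimately show ?thesis
    unfolding central_binomial_fact
    by (simp del: fact_Suc mult_Suc_right add: divide_simps) (simp add: algebra_simps)
qed

definition central_fps :: "real fps" where
  "central_fps = Abs_fps (\<lambda>n. real (2 * n choose n))"

lemma fps_nth_central [simp]: "central_fps $ n = real (2 * n choose n)"
  by (simp add: central_fps_def)

text \<open>This is the recurrence \<open>central_binomial_Suc\<close> in generating function form.
  The differential equation determines \<open>1 / sqrt (1 - 4 X)\<close> up to a constant
  factor.\<close>

lemma fps_deriv_central: "fps_deriv central_fps * (1 - fps_const 4 * fps_X) = 2 * central_fps"
proof (rule fps_ext)
  fix n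
  have *: "fps_deriv central_fps * (1 - fps_const 4 * fps_X) =
    fps_deriv central_fps - fps_const 4 * (fps_X * fps_deriv central_fps)"
    by (simp add: algebra_simps)
  show "(fps_deriv central_fps * (1 - fps_const 4 * fps_X)) $ n = (2 * central_fps) $ n"
    unfolding * using central_binomial_Suc[of n]
    by (cases n) (auto simp: numeral_fps_const algebra_simps simp del: binomial_Suc_Suc mult_Suc_right)
qed

text \<open>By the differential equation the derivative of the left-hand side vanishes, so only its
  constant coefficient 1 remains.\<close>

lemma central_fps_square: "central_fps ^ 2 * (1 - fps_const 4 * fps_X) = 1"
proof -
  let ?R = "1 - fps_const 4 * fps_X :: real fps"
  have "fps_deriv (central_fps ^ 2 * ?R) =
    2 * central_fps * (fps_deriv central_fps * ?R) - fps_const 4 * central_fps ^ 2"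
    by (simp add: power2_eq_square algebra_simps)
  also have "\<dots> = 0"
    by (simp add: fps_deriv_central numeral_fps_const power2_eq_square)
  finally have "central_fps ^ 2 * ?R = fps_const ((central_fps ^ 2 * ?R) $ 0)"
    by (subst (asm) fps_deriv_eq_0_iff)
  then show ?thesis by (simp add: power2_eq_square)
qed

text \<open>The square of the generating function is the geometric series in \<open>4 X\<close>.
  This evaluates the sum that arises for the mean.\<close>

lemma central_binomial_convolution:
  "(\<Sum>k=0..n. real (2 * k choose k) * real (2 * (n - k) choose (n - k))) = 4 ^ n"
proof -
  have *: "(central_fps ^ 2) $ n = 4 ^ n"
  proof (induction n)
    case 0
    show ?case by (simp add: power2_eq_square)
  next
    case (Suc n)
    have "central_fps ^ 2 = 1 + fps_const 4 * (fps_X * central_fps ^ 2)"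
      using central_fps_square by (simp add: algebra_simps)
    then have "(central_fps ^ 2) $ Suc n = 4 * (central_fps ^ 2) $ n"
      by (metis fps_add_nth fps_mult_left_const_nth fps_X_mult_nth fps_one_nth diff_Suc_1 add_0 nat.distinct(1))
    then show ?case using Suc by simp
  qed
  then show ?thesis by (simp add: power2_eq_square fps_mult_nth)
qed

section \<open>Full binary trees, the support of the terminal tree\<close>

inductive_set binary_trees :: "tree set" where
  leaf: "Node [] \<in> binary_trees"
| branch: "a \<in> binary_trees \<Longrightarrow> b \<in> binary_trees \<Longrightarrow> Node [a, b] \<in> binary_trees"

lemma num_leaves_leaf: "num_leaves (Node []) = 1"
proof -
  have "{v \<in> vertices (Node []). out_degree (Node []) v = 0} = {[]}"
    by (auto simp: vertices_Node)
  then show ?thesis by (simp add: num_leaves_def)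
qed

lemma vertices_Node2: "vertices (Node [a, b]) = insert [] ((#) 0 ` vertices a \<union> (#) 1 ` vertices b)"
  by (auto simp: vertices_Node lessThan_Suc numeral_2_eq_2)

lemma card_vertices_Node2: "card (vertices (Node [a, b])) = Suc (card (vertices a) + card (vertices b))"
proof -
  have "card ((#) 0 ` vertices a \<union> (#) (1 :: nat) ` vertices b) = card (vertices a) + card (vertices b)"
    by (subst card_Un_disjoint) (auto simp: card_image)
  then show ?thesis
    unfolding vertices_Node2 by (subst card_insert_disjoint) auto
qed

lemma num_fringe_leaf: "num_fringe (Node []) t = (if t = 1 then 1 else 0)"
proof -
  have "{v \<in> vertices (Node []). num_leaves (full_subtree (Node []) v) = t} = (if t = 1 then {[]} else {})"
    by (auto simp: vertices_Node num_leaves_leaf)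
  then show ?thesis by (simp add: num_fringe_def)
qed

lemma num_fringe_Node2:
  "num_fringe (Node [a, b]) t =
     (if num_leaves a + num_leaves b = t then 1 else 0) + num_fringe a t + num_fringe b t"
proof -
  let ?F = "\<lambda>T. {v \<in> vertices T. num_leaves (full_subtree T v) = t}"
  have "?F (Node [a, b]) = (if num_leaves a + num_leaves b = t then {[]} else {}) \<union>
     ((#) 0 ` ?F a \<union> (#) 1 ` ?F b)"
    by (auto simp: vertices_Node2 num_leaves_Node2)
  moreover have "card ((#) 0 ` ?F a \<union> (#) (1 :: nat) ` ?F b) = num_fringe a t + num_fringe b t"
    by (subst card_Un_disjoint) (auto simp: card_image num_fringe_def)
  ultimately show ?thesis
    unfolding num_fringe_def[of "Node [a, b]"] by (auto simp: card_insert_if)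
qed

text \<open>Induction works because a branching adds exactly one vertex to those of its two
  subtrees; \<open>Suc\<close> avoids natural subtraction. Given L, the weight of the tree and V are
  therefore both constant.\<close>

lemma card_vertices_binary: "T \<in> binary_trees \<Longrightarrow> Suc (card (vertices T)) = 2 * num_leaves T"
proof (induction rule: binary_trees.induct)
  case leaf
  then show ?case by (simp add: num_leaves_leaf vertices_Node)
next
  case (branch a b)
  then show ?case by (simp add: num_leaves_Node2 card_vertices_Node2)
qed

lemma num_leaves_pos: "T \<in> binary_trees \<Longrightarrow> num_leaves T > 0"
  using card_vertices_binary[of T] by (cases "num_leaves T") auto

lemma gw_weight_binary_trees:
  "T \<in> binary_trees \<Longrightarrow> gw_weight binary_offspring T = (1 / 2) ^ card (vertices T)"
proof (induction rule: binary_trees.induct)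
  case leaf
  then show ?case by (simp add: gw_weight_binary vertices_Node)
next
  case (branch a b)
  then show ?case by (simp add: gw_weight_binary card_vertices_Node2 power_add)
qed

lemma gw_weight_nonzero_imp: "gw_weight binary_offspring T \<noteq> 0 \<Longrightarrow> T \<in> binary_trees"
proof (induction T)
  case (Node ts)
  then have "ts = [] \<or> length ts = 2" using gw_weight_binary(3) by blast
  then show ?case
  proof
    assume "length ts = 2"
    then obtain a b where ts: "ts = [a, b]" by (auto simp: length_Suc_conv numeral_2_eq_2)
    with Node show ?thesis by (auto simp: gw_weight_binary intro!: binary_trees.branch)
  qed (simp add: binary_trees.leaf)
qed

lemma set_pmf_gw_tree: "set_pmf (gw_tree binary_offspring) = binary_trees"
  using gw_weight_nonzero_imp gw_weight_binary_trees by (auto simp: set_pmf_iff pmf_gw_tree)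

definition trees_with :: "nat \<Rightarrow> tree set" where
  "trees_with l = {T \<in> binary_trees. num_leaves T = l}"

lemma trees_with_0 [simp]: "trees_with 0 = {}"
  using num_leaves_pos by (force simp: trees_with_def)

text \<open>The root is a leaf or splits the leaves between its two subtrees. The index runs over
  all of \<open>{0..l}\<close>, with empty end terms by \<open>trees_with_0\<close>, so that sums
  over trees become Cauchy products.\<close>

lemma trees_with_eq:
  "trees_with l = (if l = 1 then {Node []} else {}) \<union>
     (\<Union>i\<in>{0..l}. (\<lambda>(a, b). Node [a, b]) ` (trees_with i \<times> trees_with (l - i)))"
proof (intro equalityI subsetI)
  fix T assume "T \<in> trees_with l"
  then have T: "T \<in> binary_trees" "num_leaves T = l" by (auto simp: trees_with_def)
  from T(1) show "T \<in> (if l = 1 then {Node []} else {}) \<union>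
     (\<Union>i\<in>{0..l}. (\<lambda>(a, b). Node [a, b]) ` (trees_with i \<times> trees_with (l - i)))"
  proof cases
    case leaf
    then show ?thesis using T by (simp add: num_leaves_leaf)
  next
    case (branch a b)
    then show ?thesis using T(2)
      by (auto simp: trees_with_def num_leaves_Node2 intro!: bexI[of _ "num_leaves a"])
  qed
qed (auto simp: trees_with_def num_leaves_leaf num_leaves_Node2 split: if_splits
       intro: binary_trees.intros)

lemma finite_trees_with [simp]: "finite (trees_with l)"
proof (induction l rule: less_induct)
  case (less l)
  \<comment> \<open>The terms \<open>i = 0\<close> and \<open>i = l\<close> are empty; in all others
    both subtrees have fewer than \<open>l\<close> leaves.\<close>
  have "finite ((\<lambda>(a, b). Node [a, b]) ` (trees_with i \<times> trees_with (l - i)))" if "i \<le> l" for i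
    using that less by (cases "i = 0 \<or> i = l") auto
  then show ?case by (subst trees_with_eq) auto
qed

lemma sum_trees_with:
  fixes f :: "tree \<Rightarrow> 'a :: comm_monoid_add"
  shows "(\<Sum>T\<in>trees_with l. f T) = (if l = 1 then f (Node []) else 0) +
    (\<Sum>i=0..l. \<Sum>a\<in>trees_with i. \<Sum>b\<in>trees_with (l - i). f (Node [a, b]))"
proof -
  let ?B = "\<lambda>i. (\<lambda>(a, b). Node [a, b]) ` (trees_with i \<times> trees_with (l - i))"
  have "(\<Sum>T\<in>trees_with l. f T) = (\<Sum>T\<in>(if l = 1 then {Node []} else {}). f T) + (\<Sum>T\<in>(\<Union>i\<in>{0..l}. ?B i). f T)"
    by (subst trees_with_eq, rule sum.union_disjoint) auto
  also have "(\<Sum>T\<in>(\<Union>i\<in>{0..l}. ?B i). f T) = (\<Sum>i=0..l. \<Sum>T\<in>?B i. f T)"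
    \<comment> \<open>The pieces are disjoint because \<open>i\<close> is the number of leaves of
      the left subtree.\<close>
    by (rule sum.UNION_disjoint) (simp_all, auto simp: trees_with_def)
  also have "\<dots> = (\<Sum>i=0..l. \<Sum>a\<in>trees_with i. \<Sum>b\<in>trees_with (l - i). f (Node [a, b]))"
    by (rule sum.cong[OF refl], subst sum.reindex)
       (auto simp: inj_on_def sum.cartesian_product intro!: sum.cong)
  finally show ?thesis by auto
qed

section \<open>Generating functions of trees and of their full subtrees\<close>

definition tree_fps :: "real fps" where
  "tree_fps = Abs_fps (\<lambda>l. real (card (trees_with l)))"

definition fringe_fps :: "nat \<Rightarrow> real fps" where
  "fringe_fps t = Abs_fps (\<lambda>l. \<Sum>T\<in>trees_with l. real (num_fringe T t))"

lemma tree_fps_eq: "tree_fps = fps_X + tree_fps ^ 2"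
proof (rule fps_ext)
  fix l
  show "tree_fps $ l = (fps_X + tree_fps ^ 2) $ l"
    using sum_trees_with[of "\<lambda>_. 1 :: real" l]
    by (simp add: tree_fps_def power2_eq_square fps_mult_nth)
qed

text \<open>A full subtree is the whole tree, counted by the first term, or lies in one of the two
  subtrees of the root. By symmetry these give equal convolutions, hence the factor 2.\<close>

lemma fringe_fps_eq:
  assumes "t \<ge> 1"
  shows "fringe_fps t = fps_const (real (card (trees_with t))) * fps_X ^ t + 2 * tree_fps * fringe_fps t"
proof (rule fps_ext)
  fix l
  let ?w = "\<lambda>i. real (card (trees_with i))" and ?N = "\<lambda>i. \<Sum>T\<in>trees_with i. real (num_fringe T t)"
  let ?d = "if l = t then 1 else 0 :: real"
  have comm: "(\<Sum>i=0..l. ?N i * ?w (l - i)) = (\<Sum>i=0..l. ?w i * ?N (l - i))"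
    using sum.atLeastAtMost_rev[of "\<lambda>i. ?N i * ?w (l - i)" 0 l] by (simp add: mult.commute)
  \<comment> \<open>The root counts only if \<open>l = t\<close>, and then once per tree. This
    identity collects these contributions, including that of the single leaf, into
    \<open>?d * ?w l\<close>.\<close>
  have card: "?w l = (if l = 1 then 1 else 0) + (\<Sum>i=0..l. ?w i * ?w (l - i))"
    using sum_trees_with[of "\<lambda>_. 1 :: real" l] by simp
  have "(\<Sum>a\<in>trees_with i. \<Sum>b\<in>trees_with (l - i). real (num_fringe (Node [a, b]) t)) =
     ?d * (?w i * ?w (l - i)) + ?N i * ?w (l - i) + ?w i * ?N (l - i)" if "i \<le> l" for i
  proof -
    have "(\<Sum>a\<in>trees_with i. \<Sum>b\<in>trees_with (l - i). real (num_fringe (Node [a, b]) t)) =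
      (\<Sum>a\<in>trees_with i. \<Sum>b\<in>trees_with (l - i). ?d + real (num_fringe a t) + real (num_fringe b t))"
      using that by (intro sum.cong refl) (auto simp: num_fringe_Node2 trees_with_def)
    also have "\<dots> = ?d * (?w i * ?w (l - i)) + ?N i * ?w (l - i) + ?w i * ?N (l - i)"
      by (simp add: sum.distrib sum_distrib_left sum_distrib_right algebra_simps)
    finally show ?thesis .
  qed
  then have "?N l = (if l = 1 \<and> t = 1 then 1 else 0) +
     (\<Sum>i=0..l. ?d * (?w i * ?w (l - i)) + ?N i * ?w (l - i) + ?w i * ?N (l - i))"
    by (subst sum_trees_with) (simp add: num_fringe_leaf)
  also have "\<dots> = ?d * ?w l + 2 * (\<Sum>i=0..l. ?w i * ?N (l - i))"
    using assms by (simp add: sum.distrib sum_distrib_left[symmetric] comm card)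
  finally have "?N l = ?d * ?w l + 2 * (\<Sum>i=0..l. ?w i * ?N (l - i))" .
  then show "fringe_fps t $ l = (fps_const (?w t) * fps_X ^ t + 2 * tree_fps * fringe_fps t) $ l"
    by (simp add: fringe_fps_def tree_fps_def fps_X_power_nth mult.assoc numeral_fps_const fps_mult_nth[of "Abs_fps _"])
qed

text \<open>By the quadratic equation for \<open>tree_fps\<close> the product squares to 1; its
  constant coefficient decides the sign.\<close>

lemma tree_fps_central: "(1 - 2 * tree_fps) * central_fps = 1"
proof -
  let ?U = "1 - 2 * tree_fps"
  have "?U ^ 2 = 1 - 4 * (tree_fps - tree_fps ^ 2)"
    by (simp add: power2_eq_square algebra_simps)
  also have "tree_fps - tree_fps ^ 2 = fps_X" by (subst tree_fps_eq) simp
  finally have "(?U * central_fps) ^ 2 = 1"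
    using central_fps_square by (simp add: power_mult_distrib mult.commute numeral_fps_const)
  moreover have "?U * central_fps \<noteq> - 1"
  proof
    assume "?U * central_fps = - 1"
    then have "(?U * central_fps) $ 0 = (- 1 :: real fps) $ 0" by simp
    then show False by (simp add: tree_fps_def numeral_fps_const)
  qed
  ultimately show ?thesis by (simp add: power2_eq_1_iff)
qed

text \<open>These are the Catalan numbers. Differentiating \<open>C = X + C\<^sup>2\<close> gives
  \<open>(1 - 2 C) C' = 1\<close>, so \<open>C'\<close> is \<open>central_fps\<close>.\<close>

lemma card_trees_with_Suc: "real (Suc n) * real (card (trees_with (Suc n))) = real (2 * n choose n)"
proof -
  let ?U = "1 - 2 * tree_fps" and ?D = "fps_deriv tree_fps"
  have "fps_deriv tree_fps = 1 + 2 * tree_fps * ?D"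
    using arg_cong[OF tree_fps_eq, of fps_deriv] by (simp add: power2_eq_square algebra_simps)
  then have "?U * ?D = 1" by (simp add: algebra_simps)
  have "?D = ?D * (?U * central_fps)" by (simp only: tree_fps_central mult_1_right)
  also have "\<dots> = (?U * ?D) * central_fps" by (simp only: mult_ac)
  also have "\<dots> = central_fps" by (simp only: \<open>?U * ?D = 1\<close> mult_1_left)
  finally have "?D = central_fps" .
  then have "?D $ n = central_fps $ n" by simp
  then show ?thesis by (simp add: tree_fps_def)
qed

text \<open>Multiplication by \<open>central_fps\<close> solves the linear equation
  \<open>fringe_fps_eq\<close>; the factor \<open>X ^ t\<close> shifts the coefficients, hence the
  case distinction.\<close>

lemma sum_num_fringe:
  assumes "1 \<le> t"
  shows "(\<Sum>T\<in>trees_with l. real (num_fringe T t)) =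
    (if t \<le> l then real (card (trees_with t)) * real (2 * (l - t) choose (l - t)) else 0)"
proof -
  let ?A = "fps_const (real (card (trees_with t))) * fps_X ^ t"
  have "fringe_fps t * (1 - 2 * tree_fps) = ?A"
    using fringe_fps_eq[OF assms] by (simp add: algebra_simps)
  then have "fringe_fps t = ?A * central_fps"
    using tree_fps_central by (metis mult.assoc mult_1_right)
  then have "fringe_fps t $ l = (?A * central_fps) $ l" by simp
  then show ?thesis by (simp add: fringe_fps_def mult.assoc fps_X_power_mult_nth)
qed

section \<open>The law conditioned on the number of leaves, and its exact formula\<close>

lemma gw_tree_Int_num_leaves:
  "{T. num_leaves T = l} \<inter> set_pmf (gw_tree binary_offspring) = trees_with l"
  by (auto simp: trees_with_def set_pmf_gw_tree)

lemma pmf_gw_tree_trees_with: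
  assumes "T \<in> trees_with l"
  shows "pmf (gw_tree binary_offspring) T = 1 / 2 ^ (2 * l - 1)"
proof -
  have "card (vertices T) = 2 * l - 1"
    using card_vertices_binary[of T] assms by (auto simp: trees_with_def)
  then show ?thesis
    using assms by (simp add: pmf_gw_tree gw_weight_binary_trees trees_with_def power_one_over)
qed

lemma prob_num_leaves:
  "measure_pmf.prob (gw_tree binary_offspring) {T. num_leaves T = l} =
     real (card (trees_with l)) / 2 ^ (2 * l - 1)"
proof -
  have "measure_pmf.prob (gw_tree binary_offspring) {T. num_leaves T = l} =
     measure_pmf.prob (gw_tree binary_offspring) (trees_with l)"
    using measure_Int_set_pmf[of "gw_tree binary_offspring" "{T. num_leaves T = l}"]
    by (simp add: gw_tree_Int_num_leaves)
  also have "\<dots> = real (card (trees_with l)) / 2 ^ (2 * l - 1)"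
    by (simp add: measure_measure_pmf_finite pmf_gw_tree_trees_with)
  finally show ?thesis .
qed

lemma trees_with_nonempty: "l \<ge> 1 \<Longrightarrow> trees_with l \<noteq> {}"
  using exists_binary_tree gw_tree_Int_num_leaves by blast

text \<open>All trees with \<open>l\<close> leaves have the same weight, which cancels against the
  normalisation.\<close>

lemma cond_gw_tree_num_leaves:
  assumes "l \<ge> 1"
  shows "cond_pmf (gw_tree binary_offspring) {T. num_leaves T = l} = pmf_of_set (trees_with l)"
proof (rule pmf_eqI)
  fix T
  have ne: "set_pmf (gw_tree binary_offspring) \<inter> {T. num_leaves T = l} \<noteq> {}"
    using trees_with_nonempty[OF assms] gw_tree_Int_num_leaves[of l] by blast
  show "pmf (cond_pmf (gw_tree binary_offspring) {T. num_leaves T = l}) T = pmf (pmf_of_set (trees_with l)) T"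
  proof (cases "T \<in> trees_with l")
    case True
    then have "num_leaves T = l" by (simp add: trees_with_def)
    then show ?thesis using True trees_with_nonempty[OF assms]
      by (simp add: pmf_cond[OF ne] prob_num_leaves pmf_gw_tree_trees_with)
  next
    case False
    then have "num_leaves T \<noteq> l \<or> pmf (gw_tree binary_offspring) T = 0"
      using gw_tree_Int_num_leaves[of l] by (auto simp: pmf_eq_0_set_pmf)
    then show ?thesis using False trees_with_nonempty[OF assms]
      by (auto simp: pmf_cond[OF ne])
  qed
qed

text \<open>On the conditioning event V is the constant 2l - 1, so the mean of X(t) / V reduces to a
  plain average of X(t).\<close>

lemma pmf_fringe_law_sum:
  assumes "l \<ge> 1"
  shows "pmf (fringe_law binary_offspring l) t =
    (\<Sum>T\<in>trees_with l. real (num_fringe T t)) / ((2 * real l - 1) * real (card (trees_with l)))"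
proof -
  have "real (card (vertices T)) = 2 * real l - 1" if "T \<in> trees_with l" for T
    using card_vertices_binary[of T] that by (auto simp: trees_with_def)
  then have "(\<Sum>T\<in>trees_with l. real (num_fringe T t) / real (card (vertices T))) =
    (\<Sum>T\<in>trees_with l. real (num_fringe T t)) / (2 * real l - 1)"
    by (simp add: sum_divide_distrib)
  then show ?thesis
    using trees_with_nonempty[OF assms]
    by (simp add: pmf_fringe_law[OF assms] cond_gw_tree_num_leaves[OF assms] integral_pmf_of_set)
qed

text \<open>Handles \<open>t = 0\<close>, which \<open>sum_num_fringe\<close> leaves out, when the
  support of the law is located.\<close>

lemma num_fringe_0: "T \<in> binary_trees \<Longrightarrow> num_fringe T 0 = 0"
proof (induction rule: binary_trees.induct)
  case (branch a b)
  then show ?case using num_leaves_pos[of a] by (simp add: num_fringe_Node2)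
qed (simp add: num_fringe_leaf)

lemma set_pmf_fringe_law:
  assumes "l \<ge> 1"
  shows "set_pmf (fringe_law binary_offspring l) \<subseteq> {1..l}"
proof
  fix t assume t: "t \<in> set_pmf (fringe_law binary_offspring l)"
  then have "(\<Sum>T\<in>trees_with l. real (num_fringe T t)) \<noteq> 0"
    by (auto simp: set_pmf_iff pmf_fringe_law_sum[OF assms])
  moreover have "(\<Sum>T\<in>trees_with l. real (num_fringe T 0)) = 0"
    by (rule sum.neutral) (auto simp: num_fringe_0 trees_with_def)
  then have "t \<noteq> 0" using calculation by metis
  ultimately show "t \<in> {1..l}"
    using sum_num_fringe[of t l] by (auto split: if_splits)
qed

lemma pmf_fringe_law_card:
  assumes "1 \<le> t" "t \<le> l"
  shows "pmf (fringe_law binary_offspring l) t =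
    real (card (trees_with t)) * real (2 * (l - t) choose (l - t)) /
      ((2 * real l - 1) * real (card (trees_with l)))"
  using assms by (simp add: pmf_fringe_law_sum sum_num_fringe)

lemma card_trees_with:
  assumes "l \<ge> 1"
  shows "real (card (trees_with l)) = real (2 * (l - 1) choose (l - 1)) / real l"
  using card_trees_with_Suc[of "l - 1"] assms by (simp add: field_simps)

lemma pmf_fringe_law_binomial:
  assumes "1 \<le> t" "t \<le> l"
  shows "pmf (fringe_law binary_offspring l) t =
    real t / (real l * (2 * real l - 1)) *
      (real (l choose t) ^ 2 / real ((2 * (l - 1)) choose (2 * (t - 1))))"
proof -
  \<comment> \<open>With \<open>t = s + 1\<close> and \<open>l = s + d + 1\<close> no truncated
    subtraction remains, and all binomials become quotients of factorials.\<close>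
  define s d where "s = t - 1" and "d = l - t"
  have t: "t = Suc s" and l: "l = Suc (s + d)" using assms by (auto simp: s_def d_def)
  have 1: "real (2 * n choose n) = fact (2 * n) / (fact n * fact n)" for n
    by (rule central_binomial_fact)
  have 2: "real (2 * (s + d) choose (2 * s)) = fact (2 * (s + d)) / (fact (2 * s) * fact (2 * d))"
    by (subst binomial_fact) (simp_all add: algebra_simps)
  have 3: "real (Suc (s + d) choose Suc s) =
      (real (s + d) + 1) * fact (s + d) / ((real s + 1) * fact s * fact d)"
    by (subst binomial_fact) (simp_all add: algebra_simps)
  have nz: "2 * (real s + real d) + 1 \<noteq> 0" "real s + real d + 1 \<noteq> 0" "real s + 1 \<noteq> 0"
    by (smt (verit) of_nat_0_le_iff)+
  have "pmf (fringe_law binary_offspring l) t =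
    real (2 * s choose s) / real t * real (2 * d choose d) /
      ((2 * real l - 1) * (real (2 * (s + d) choose (s + d)) / real l))"
    using assms by (simp add: pmf_fringe_law_card card_trees_with) (simp add: t l)
  also have "\<dots> = real t / (real l * (2 * real l - 1)) *
      (real (l choose t) ^ 2 / real ((2 * (l - 1)) choose (2 * (t - 1))))"
    unfolding t l diff_Suc_1 1 2 3 using nz
    by (simp add: power2_eq_square divide_simps del: fact_Suc) (simp add: algebra_simps)
  finally show ?thesis .
qed

section \<open>Comparison with the unconditioned number of leaves\<close>

text \<open>The probability that a simple random walk on the integers is at its starting point at time \<open>2n\<close>.\<close>

definition return_prob :: "nat \<Rightarrow> real" where
  "return_prob n = real (2 * n choose n) / 4 ^ n"

lemma return_prob_0 [simp]: "return_prob 0 = 1"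
  by (simp add: return_prob_def)

lemma return_prob_Suc: "2 * (real n + 1) * return_prob (Suc n) = (2 * real n + 1) * return_prob n"
proof -
  have "2 * (real n + 1) * return_prob (Suc n) =
    2 / 4 ^ Suc n * (real (Suc n) * real (2 * Suc n choose Suc n))"
    by (simp add: return_prob_def field_simps del: binomial_Suc_Suc mult_Suc_right)
  also have "\<dots> = (2 * real n + 1) * return_prob n"
    unfolding central_binomial_Suc by (simp add: return_prob_def field_simps)
  finally show ?thesis .
qed

lemma return_prob_pos: "return_prob n > 0"
  by (simp add: return_prob_def)

lemma decseq_return_prob: "decseq return_prob"
proof (rule decseq_SucI)
  fix n
  have "2 * (real n + 1) * return_prob (Suc n) \<le> 2 * (real n + 1) * return_prob n"
    unfolding return_prob_Suc using return_prob_pos[of n] by (intro mult_right_mono) auto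
  then show "return_prob (Suc n) \<le> return_prob n" by (simp add: mult_le_cancel_left_pos)
qed

text \<open>By \<open>return_prob_Suc\<close> the increment is
  \<open>return_prob n / 2\<close>.\<close>

lemma incseq_mult_return_prob: "incseq (\<lambda>n. real n * return_prob n)"
proof (rule incseq_SucI)
  fix n
  show "real n * return_prob n \<le> real (Suc n) * return_prob (Suc n)"
    using return_prob_Suc[of n] return_prob_pos[of n] by (simp add: algebra_simps)
qed

text \<open>Normalising the central binomials leaves the power \<open>4 / 4 ^ t\<close>, which is
  twice the weight \<open>1 / 2 ^ (2 * t - 1)\<close> of a tree with \<open>t\<close> leaves; hence
  P(L = t) and the 2 in the numerator.\<close>

lemma pmf_fringe_law_return_prob:
  assumes "1 \<le> t" "t \<le> l"
  shows "pmf (fringe_law binary_offspring l) t =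
    2 * real l / (2 * real l - 1) * (return_prob (l - t) / return_prob (l - 1)) *
      measure_pmf.prob (gw_tree binary_offspring) {T. num_leaves T = t}"
proof -
  define s d where "s = t - 1" and "d = l - t"
  have t: "t = Suc s" and l: "l = Suc (s + d)" using assms by (auto simp: s_def d_def)
  have [simp]: "(2 :: real) ^ (2 * s) = 4 ^ s" by (simp add: power_mult)
  show ?thesis
    using assms by (simp add: pmf_fringe_law_card card_trees_with prob_num_leaves return_prob_def)
      (simp add: t l power_add divide_simps, simp add: algebra_simps)
qed

lemma fringe_ratio_le:
  assumes "1 \<le> t" "2 * t \<le> l" "2 \<le> l"
  defines "r \<equiv> 2 * real l / (2 * real l - 1) * (return_prob (l - t) / return_prob (l - 1))"
  shows "r \<le> 1 + 2 * (real t / real l)"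
proof -
  have pos: "real (l - t) > 0" "2 * real l - 1 > 0" using assms by auto
  have "real (l - t) * return_prob (l - t) \<le> real (l - 1) * return_prob (l - 1)"
    using assms by (intro incseqD[OF incseq_mult_return_prob]) auto
  then have "return_prob (l - t) / return_prob (l - 1) \<le> (real l - 1) / (real l - real t)"
    using return_prob_pos[of "l - 1"] pos assms by (simp add: field_simps of_nat_diff)
  then have "r \<le> 2 * real l / (2 * real l - 1) * ((real l - 1) / (real l - real t))"
    unfolding r_def using pos by (intro mult_left_mono) auto
  \<comment> \<open>The regrouping pairs \<open>2 * l - 2\<close> with \<open>2 * l - 1\<close>, a
    quotient below 1, so the prefactor costs nothing.\<close>
  also have "\<dots> = real l / (real l - real t) * ((2 * real l - 2) / (2 * real l - 1))"
    by (simp only: times_divide_times_eq) (simp add: algebra_simps)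
  also have "\<dots> \<le> real l / (real l - real t) * 1"
    using pos assms by (intro mult_left_mono) auto
  also have "\<dots> = 1 + real t / (real l - real t)"
    using pos assms by (simp add: field_simps)
  \<comment> \<open>Here \<open>2 * t \<le> l\<close> enters: \<open>l - t\<close> is at least
    \<open>l / 2\<close>.\<close>
  also have "real t / (real l - real t) \<le> real t / (real l / 2)"
    using assms by (intro divide_left_mono) auto
  finally show ?thesis by (simp add: mult.commute)
qed

text \<open>Both factors are at least 1, the second one because \<open>return_prob\<close>
  decreases.\<close>

lemma fringe_ratio_ge_1:
  assumes "1 \<le> t" "t \<le> l"
  shows "1 \<le> 2 * real l / (2 * real l - 1) * (return_prob (l - t) / return_prob (l - 1))"
proof -
  have "return_prob (l - 1) \<le> return_prob (l - t)"
    using assms by (intro decseqD[OF decseq_return_prob]) auto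
  then have "1 \<le> return_prob (l - t) / return_prob (l - 1)"
    using return_prob_pos[of "l - 1"] by simp
  moreover have "1 \<le> 2 * real l / (2 * real l - 1)" using assms by simp
  ultimately show ?thesis using mult_mono[of 1 _ 1] by fastforce
qed

lemma prob_num_leaves_le_pmf_fringe_law:
  assumes "1 \<le> t" "t \<le> l"
  shows "measure_pmf.prob (gw_tree binary_offspring) {T. num_leaves T = t} \<le>
    pmf (fringe_law binary_offspring l) t"
  unfolding pmf_fringe_law_return_prob[OF assms]
  using mult_right_mono[OF fringe_ratio_ge_1[OF assms] measure_nonneg] by simp

section \<open>Tightness\<close>

lemma num_leaves_bounded_in_prob:
  assumes "\<epsilon> > 0"
  shows "\<exists>M. measure_pmf.prob (gw_tree binary_offspring) {T. num_leaves T \<le> M} > 1 - \<epsilon>"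
proof -
  let ?P = "gw_tree binary_offspring"
  have "(\<lambda>M. measure_pmf.prob ?P {T. num_leaves T \<le> M}) \<longlonglongrightarrow> measure_pmf.prob ?P (\<Union>M. {T. num_leaves T \<le> M})"
    by (rule measure_pmf.finite_Lim_measure_incseq) (auto simp: incseq_def)
  also have "(\<Union>M. {T. num_leaves T \<le> M}) = UNIV" by auto
  finally have "(\<lambda>M. measure_pmf.prob ?P {T. num_leaves T \<le> M}) \<longlonglongrightarrow> 1" by simp
  then have "\<forall>\<^sub>F M in sequentially. measure_pmf.prob ?P {T. num_leaves T \<le> M} > 1 - \<epsilon>"
    by (rule order_tendstoD) (use assms in simp)
  then show ?thesis by (auto simp: eventually_sequentially)
qed

text \<open>
  Stochastic domination by the number of leaves of the unconditioned tree makes tightness immediate.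
\<close>

lemma prob_num_leaves_le_fringe_law:
  assumes "l \<ge> 1"
  shows "measure_pmf.prob (gw_tree binary_offspring) {T. num_leaves T \<le> M} \<le>
    measure_pmf.prob (fringe_law binary_offspring l) {1..M}"
proof (cases "l \<le> M")
  \<comment> \<open>Pointwise domination is available only for \<open>t \<le> l\<close>. If
    \<open>l \<le> M\<close>, the law is carried by \<open>{1..M}\<close> and the bound is
    trivial.\<close>
  case True
  then have "measure_pmf.prob (fringe_law binary_offspring l) {1..M} = 1"
    using set_pmf_fringe_law[OF assms] by (subst measure_pmf.prob_eq_1) (auto simp: AE_measure_pmf_iff)
  then show ?thesis by simp
next
  case False
  let ?P = "map_pmf num_leaves (gw_tree binary_offspring)"
  have "measure_pmf.prob (gw_tree binary_offspring) {T. num_leaves T \<le> M} = measure_pmf.prob ?P {..M}"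
    by (simp add: vimage_def)
  \<comment> \<open>A tree in the support has at least one leaf, so dropping 0 changes
    nothing.\<close>
  also have "\<dots> = measure_pmf.prob ?P {1..M}"
    by (rule measure_prob_cong_0)
       (auto simp: pmf_eq_0_set_pmf set_pmf_gw_tree Suc_le_eq dest: num_leaves_pos)
  also have "\<dots> = (\<Sum>t=1..M. pmf ?P t)"
    by (rule measure_measure_pmf_finite) simp
  also have "\<dots> \<le> (\<Sum>t=1..M. pmf (fringe_law binary_offspring l) t)"
  proof (rule sum_mono)
    fix t assume "t \<in> {1..M}"
    then show "pmf ?P t \<le> pmf (fringe_law binary_offspring l) t"
      using prob_num_leaves_le_pmf_fringe_law[of t l] False by (simp add: pmf_map vimage_def)
  qed
  also have "\<dots> = measure_pmf.prob (fringe_law binary_offspring l) {1..M}"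
    by (simp add: measure_measure_pmf_finite)
  finally show ?thesis .
qed

text \<open>The index is shifted because the law is unspecified for \<open>l = 0\<close>.\<close>

lemma tight_fringe_law:
  "tight (\<lambda>n. distr (measure_pmf (fringe_law binary_offspring (Suc n))) borel real)"
  unfolding tight_def
proof (intro conjI allI impI)
  fix n
  show "real_distribution (distr (measure_pmf (fringe_law binary_offspring (Suc n))) borel real)"
    by (intro prob_space.real_distribution_distr measure_pmf.prob_space_axioms) simp
next
  fix \<epsilon> :: real assume "\<epsilon> > 0"
  then obtain M where M: "measure_pmf.prob (gw_tree binary_offspring) {T. num_leaves T \<le> M} > 1 - \<epsilon>"
    using num_leaves_bounded_in_prob by blast
  have "1 - \<epsilon> < measure (distr (measure_pmf (fringe_law binary_offspring (Suc n))) borel real)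
      {0<..real (Suc M)}" for n
  proof -
    note M
    also have "measure_pmf.prob (gw_tree binary_offspring) {T. num_leaves T \<le> M} \<le>
      measure_pmf.prob (fringe_law binary_offspring (Suc n)) {1..M}"
      by (rule prob_num_leaves_le_fringe_law) simp
    also have "\<dots> \<le> measure_pmf.prob (fringe_law binary_offspring (Suc n)) (real -` {0<..real (Suc M)})"
      by (rule measure_pmf.finite_measure_mono) auto
    also have "\<dots> = measure (distr (measure_pmf (fringe_law binary_offspring (Suc n))) borel real)
      {0<..real (Suc M)}"
      by (subst measure_distr) auto
    finally show ?thesis .
  qed
  then show "\<exists>a b. a < b \<and> (\<forall>n. 1 - \<epsilon> <
     measure (distr (measure_pmf (fringe_law binary_offspring (Suc n))) borel real) {a<..b})"
    \<comment> \<open>The right end \<open>Suc M\<close> keeps the interval nondegenerate even for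
      \<open>M = 0\<close>.\<close>
    by (intro exI[of _ 0] exI[of _ "real (Suc M)"]) auto
qed

section \<open>The mean and Wallis' product\<close>

lemma expectation_fringe_law:
  "measure_pmf.expectation (fringe_law binary_offspring (Suc n)) real =
     (real n + 1) / ((2 * real n + 1) * return_prob n)"
proof -
  let ?l = "Suc n"
  let ?D = "(2 * real ?l - 1) * real (card (trees_with ?l))"
  have "measure_pmf.expectation (fringe_law binary_offspring ?l) real =
    (\<Sum>t=1..?l. real t * pmf (fringe_law binary_offspring ?l) t)"
    using set_pmf_fringe_law[of ?l] by (subst integral_measure_pmf_real[of "{1..?l}"]) auto
  also have "\<dots> = (\<Sum>s=0..n. real (Suc s) * pmf (fringe_law binary_offspring ?l) (Suc s))"
    by (simp only: One_nat_def sum.shift_bounds_cl_Suc_ivl)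
  \<comment> \<open>The factor \<open>t = s + 1\<close> cancels the denominator of the Catalan
    number and leaves a convolution of central binomials.\<close>
  also have "\<dots> = (\<Sum>s=0..n. real (2 * s choose s) * real (2 * (n - s) choose (n - s)) / ?D)"
  proof (rule sum.cong[OF refl])
    fix s assume "s \<in> {0..n}"
    then have "real (Suc s) * pmf (fringe_law binary_offspring ?l) (Suc s) =
      (real (Suc s) * real (card (trees_with (Suc s)))) * real (2 * (n - s) choose (n - s)) / ?D"
      by (subst pmf_fringe_law_card) auto
    then show "real (Suc s) * pmf (fringe_law binary_offspring ?l) (Suc s) =
      real (2 * s choose s) * real (2 * (n - s) choose (n - s)) / ?D"
      by (simp only: card_trees_with_Suc)
  qed
  also have "\<dots> = 4 ^ n / ?D"
    by (simp only: sum_divide_distrib[symmetric] central_binomial_convolution)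
  also have "?D = (2 * real n + 1) * real (2 * n choose n) / (real n + 1)"
    by (simp add: card_trees_with algebra_simps)
  finally show ?thesis by (simp add: return_prob_def)
qed

text \<open>By \<open>return_prob_Suc\<close> both sides gain the same factor from \<open>n\<close>
  to \<open>n + 1\<close>. The limit \<open>wallis\<close> thus gives the asymptotics of
  \<open>return_prob\<close>.\<close>

lemma wallis_return_prob:
  "(\<Prod>k=1..n. (4 * real k ^ 2) / (4 * real k ^ 2 - 1)) = 1 / ((2 * real n + 1) * return_prob n ^ 2)"
proof (induction n)
  case (Suc n)
  have a: "return_prob n = 2 * (real n + 1) / (2 * real n + 1) * return_prob (Suc n)"
    using return_prob_Suc[of n] by (simp add: field_simps)
  have "4 * real (Suc n) ^ 2 - 1 = (2 * real n + 1) * (2 * real n + 3)"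
    by (simp add: power2_eq_square algebra_simps)
  then have "(\<Prod>k=1..Suc n. (4 * real k ^ 2) / (4 * real k ^ 2 - 1)) =
    1 / ((2 * real n + 1) * return_prob n ^ 2) *
      (4 * (real n + 1) ^ 2 / ((2 * real n + 1) * (2 * real n + 3)))"
    using Suc by (simp add: add.commute)
  also have "\<dots> = 1 / ((2 * real (Suc n) + 1) * return_prob (Suc n) ^ 2)"
    unfolding a using return_prob_pos[of "Suc n"]
    by (simp add: power2_eq_square divide_simps) (simp add: algebra_simps)
  finally show ?case .
qed simp

lemma expectation_fringe_law_asymp:
  "(\<lambda>l. measure_pmf.expectation (fringe_law binary_offspring l) real)
     \<sim>[sequentially] (\<lambda>l. sqrt (pi * real l) / 2)"
proof (rule asymp_equivI', subst filterlim_sequentially_Suc[symmetric])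
  let ?W = "\<lambda>n. \<Prod>k=1..n. (4 * real k ^ 2) / (4 * real k ^ 2 - 1)"
  have "(\<lambda>n. (real n + 1) / (2 * real n + 1)) \<longlonglongrightarrow> 1 / 2"
    by real_asymp
  from tendsto_mult[OF this wallis]
  have "(\<lambda>n. 4 / pi * ((real n + 1) / (2 * real n + 1) * ?W n)) \<longlonglongrightarrow> 4 / pi * (1 / 2 * (pi / 2))"
    by (rule tendsto_mult_left)
  \<comment> \<open>These are the squared quotients of the mean and \<open>sqrt (pi * l) / 2\<close>
    at \<open>l = n + 1\<close>. Squaring brings in \<open>return_prob n ^ 2\<close>, which Wallis'
    product controls.\<close>
  then have "(\<lambda>n. sqrt (4 / pi * ((real n + 1) / (2 * real n + 1) * ?W n))) \<longlonglongrightarrow> sqrt 1"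
    by (intro tendsto_real_sqrt) simp
  also have "(\<lambda>n. sqrt (4 / pi * ((real n + 1) / (2 * real n + 1) * ?W n))) =
    (\<lambda>n. measure_pmf.expectation (fringe_law binary_offspring (Suc n)) real / (sqrt (pi * real (Suc n)) / 2))"
  proof
    fix n
    let ?e = "(real n + 1) / ((2 * real n + 1) * return_prob n)"
    have "4 / pi * ((real n + 1) / (2 * real n + 1) * ?W n) = ?e ^ 2 / (pi * (real n + 1) / 2 ^ 2)"
      using return_prob_pos[of n] unfolding wallis_return_prob
      by (simp add: power2_eq_square divide_simps)
    also have "sqrt \<dots> = ?e / (sqrt (pi * (real n + 1)) / 2)"
      using return_prob_pos[of n]
      by (simp only: real_sqrt_divide real_sqrt_abs) (simp add: abs_of_nonneg)
    finally show "sqrt (4 / pi * ((real n + 1) / (2 * real n + 1) * ?W n)) =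
      measure_pmf.expectation (fringe_law binary_offspring (Suc n)) real / (sqrt (pi * real (Suc n)) / 2)"
      by (simp add: expectation_fringe_law add.commute)
  qed
  finally show "(\<lambda>n. measure_pmf.expectation (fringe_law binary_offspring (Suc n)) real / (sqrt (pi * real (Suc n)) / 2)) \<longlonglongrightarrow> 1"
    by simp
qed

section \<open>The local limit with error term\<close>

lemma fringe_law_local_limit:
  assumes t: "\<And>l. 1 \<le> t l" "(\<lambda>l. real (t l)) \<in> o(\<lambda>l. real l)"
  shows "\<exists>e. e \<in> O(\<lambda>l. real l powr (- 1 / 2) + real (t l) / real l) \<and>
    (\<forall>\<^sub>F l in sequentially. pmf (fringe_law binary_offspring l) (t l) =
       (1 + e l) * measure_pmf.prob (gw_tree binary_offspring) {T. num_leaves T = t l})"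
proof (intro exI conjI)
  \<comment> \<open>This is the exact relative error, so only its size has to be estimated.\<close>
  define e where "e l = 2 * real l / (2 * real l - 1) * (return_prob (l - t l) / return_prob (l - 1)) - 1" for l
  \<comment> \<open>The constant 1/2 in the little-o condition yields
    \<open>2 * t l \<le> l\<close>, as \<open>fringe_ratio_le\<close> requires.\<close>
  have "\<forall>\<^sub>F l in sequentially. norm (real (t l)) \<le> 1 / 2 * norm (real l)"
    using t(2) by (rule landau_o.smallD) simp
  then have small: "\<forall>\<^sub>F l in sequentially. 2 * t l \<le> l \<and> 2 \<le> l"
    using eventually_ge_at_top[of 2] by eventually_elim auto
  show "e \<in> O(\<lambda>l. real l powr (- 1 / 2) + real (t l) / real l)"
  proof (rule bigoI[of _ 2])
    show "\<forall>\<^sub>F l in sequentially. norm (e l) \<le> 2 * norm (real l powr (- 1 / 2) + real (t l) / real l)"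
      using small
    proof eventually_elim
      case (elim l)
      \<comment> \<open>The error lies between 0 and twice the second of two nonnegative terms,
        hence is at most twice their sum.\<close>
      have aux: "\<bar>x\<bar> \<le> 2 * \<bar>p + q\<bar>" if "0 \<le> x" "x \<le> 2 * q" "0 \<le> p" "0 \<le> q" for x p q :: real
        using that by simp
      from elim have "0 \<le> e l" "e l \<le> 2 * (real (t l) / real l)"
        using fringe_ratio_ge_1[of "t l" l] fringe_ratio_le[of "t l" l] t(1)[of l]
        by (auto simp: e_def)
      moreover have "0 \<le> real l powr (- 1 / 2)" "0 \<le> real (t l) / real l" by simp_all
      ultimately show ?case unfolding real_norm_def by (rule aux)
    qed
  qed
  show "\<forall>\<^sub>F l in sequentially. pmf (fringe_law binary_offspring l) (t l) =
       (1 + e l) * measure_pmf.prob (gw_tree binary_offspring) {T. num_leaves T = t l}"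
    using small
  proof eventually_elim
    case (elim l)
    then show ?case using pmf_fringe_law_return_prob[of "t l" l] t(1)[of l] by (simp add: e_def)
  qed
qed

theorem theorem1p1:
  shows
    "(\<forall>l t :: nat. 1 \<le> t \<and> t \<le> l \<longrightarrow>
        pmf (fringe_law binary_offspring l) t =
          real t / (real l * (2 * real l - 1)) *
          (real (l choose t) ^ 2 / real ((2 * (l - 1)) choose (2 * (t - 1)))))
   \<and> (\<forall>t :: nat \<Rightarrow> nat. (\<forall>l. 1 \<le> t l) \<and> (\<lambda>l. real (t l)) \<in> o(\<lambda>l. real l) \<longrightarrow>
        (\<exists>e :: nat \<Rightarrow> real. e \<in> O(\<lambda>l. real l powr (- 1 / 2) + real (t l) / real l) \<and>
          (\<forall>\<^sub>F l in sequentially.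
             pmf (fringe_law binary_offspring l) (t l) =
               (1 + e l) / (2 ^ (2 * t l - 1) * real (t l)) *
               real ((2 * (t l - 1)) choose (t l - 1)) \<and>
             pmf (fringe_law binary_offspring l) (t l) =
               (1 + e l) *
               measure_pmf.prob (gw_tree binary_offspring) {T. num_leaves T = t l})))
   \<and> tight (\<lambda>n. distr (measure_pmf (fringe_law binary_offspring (Suc n))) borel real)
   \<and> (\<lambda>l. measure_pmf.expectation (fringe_law binary_offspring l) real)
        \<sim>[sequentially] (\<lambda>l. sqrt (pi * real l) / 2)"
proof (intro conjI allI impI tight_fringe_law expectation_fringe_law_asymp, goal_cases)
  case (1 l t)
  then show ?case using pmf_fringe_law_binomial by blast
next
  case (2 t)
  \<comment> \<open>The closed form of P(L = t) converts one representation in (ii) into the other,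
    so a single error function serves both.\<close>
  have "measure_pmf.prob (gw_tree binary_offspring) {T. num_leaves T = t l} =
      1 / (2 ^ (2 * t l - 1) * real (t l)) * real ((2 * (t l - 1)) choose (t l - 1))" for l
    using 2 by (simp add: prob_num_leaves card_trees_with)
  moreover obtain e where "e \<in> O(\<lambda>l. real l powr (- 1 / 2) + real (t l) / real l)"
    "\<forall>\<^sub>F l in sequentially. pmf (fringe_law binary_offspring l) (t l) =
       (1 + e l) * measure_pmf.prob (gw_tree binary_offspring) {T. num_leaves T = t l}"
    using fringe_law_local_limit[of t] 2 by blast
  ultimately show ?case by (intro exI[of _ e]) simp
qed

end
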